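(* For every integer $n\geq 1$, the $n$th Dowling number $D_n$ is given by \[D_n=\sum_{i=0}^{n}\binom{n}{i}\sum_{k=0}^{n-i}2^{n-i-k}\,S(n-i,k).\]
   Context: The Dowling numbers $D_n$ (OEIS A007405) enumerate type $B$ set partitions: $D_n$ is the number of type $B$ set partitions of the set $[-n,n]$ of integers from $-n$ to $n$. A type $B$ set partition of $[-n,n]$ is a collection $\mathcal{B}$ of pairwise disjoint subsets (blocks) of $[-n,n]$ whose union is $[-n,n]$, such that (i) if $\beta\in\mathcal{B}$ then $-\beta:=\{-b: b\in\beta\}\in\mathcal{B}$, and (ii) there is exactly one block $\beta\in\mathcal{B}$ with $\beta=-\beta$. $S(a,b)$ denotes the Stirling number of the second kind (the number of partitions of an $a$-element set into $b$ nonempty blocks), with the usual conventions $S(0,0)=1$ and $S(a,0)=0$ for $a\geq 1$. *)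

theory Defs
  imports "HOL-Library.Disjoint_Sets" "HOL-Combinatorics.Stirling"
begin

text \<open>
  Condition (ii) already rules out an empty block: the block containing \<open>0\<close> is fixed by
  negation, and so would be the empty set. Hence the nonemptiness that is built into
  \<^const>\<open>partition_on\<close> is no additional restriction.
\<close>

definition type_B_partition :: "nat \<Rightarrow> int set set \<Rightarrow> bool" where
  "type_B_partition n \<B> \<longleftrightarrow>
     partition_on {- int n..int n} \<B> \<and>
     (\<forall>\<beta>\<in>\<B>. uminus ` \<beta> \<in> \<B>) \<and>
     (\<exists>!\<beta>. \<beta> \<in> \<B> \<and> uminus ` \<beta> = \<beta>)"

definition dowling_number :: "nat \<Rightarrow> nat" where
  "dowling_number n = card {\<B>. type_B_partition n \<B>}"

text \<open>
  The library introduces \<^const>\<open>Stirling\<close> by its recurrence; the following lemma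
  confirms that it counts set partitions by number of blocks.
\<close>

lemma card_partition_on_eq_Stirling:
  fixes A :: "'a set"
  assumes "finite A"
  shows "card {P. partition_on A P \<and> card P = k} = Stirling (card A) k"
  using assms
proof (induction A arbitrary: k rule: finite_induct)
  case empty
  have "{P. partition_on {} P \<and> card P = k} = (if k = 0 then {{}} else ({} :: 'a set set set))"
    by (auto simp: partition_on_empty)
  then show ?case by (cases k) (simp_all only: Stirling.simps card.empty if_True if_False, simp_all)
next
  case (insert x A)
  let ?Q = "\<lambda>k. {P. partition_on A P \<and> card P = k}"
  have fin: "finite P" if "partition_on A P" for P
    using finite_elements[OF insert.hyps(1) that] .
  have finQ: "finite (?Q k)" for k
    using finitely_many_partition_on[OF insert.hyps(1)] by (rule rev_finite_subset) auto
  have xP: "x \<notin> p" if "partition_on A P" "p \<in> P" for P p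
    using partition_onD1[OF that(1)] that(2) insert.hyps(2) by auto
  show ?case
  proof (cases k)
    case 0
    have "{P. partition_on (insert x A) P \<and> card P = 0} = {}"
    proof -
      have "P \<noteq> {}" "finite P" if "partition_on (insert x A) P" for P
        using that finite_elements[OF _ that] insert.hyps(1) by (auto simp: partition_on_def)
      then show ?thesis by (auto simp: card_gt_0_iff)
    qed
    with 0 insert.hyps show ?thesis by (simp only: card_insert_disjoint) simp
  next
    case (Suc j)
    define f where "f = (\<lambda>(P, p). Set.insert (Set.insert x p) (P - {p}))"
    define L where "L = Set.insert {x} ` ?Q j"
    define R where "R = f ` (SIGMA P:?Q (Suc j). P)"
    have "{P. partition_on (insert x A) P \<and> card P = Suc j} = L \<union> R"
    proof (intro equalityI subsetI)
      fix P assume "P \<in> {P. partition_on (insert x A) P \<and> card P = Suc j}"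
      then have P: "partition_on (insert x A) P" and c: "card P = Suc j" by auto
      have finP: "finite P" using c card_ge_0_finite by force
      obtain q where q: "q \<in> P" "x \<in> q" using partition_onD1[OF P] by auto
      have oth: "x \<notin> r" "disjnt q r" if "r \<in> P" "r \<noteq> q" for r
        using partition_onD2[OF P] that q by (auto simp: disjoint_def disjnt_def)
      have Pq: "P = Set.insert q (P - {q})" using q by auto
      have D: "partition_on (insert x A - q) (P - {q})"
      proof -
        have "disjnt q (\<Union>(P - {q}))" using oth(2) by (force simp: disjnt_def)
        then show ?thesis using partition_on_insert[of q "P - {q}"] P Pq by metis
      qed
      have cj: "card (P - {q}) = j" using c finP q by simp
      show "P \<in> L \<union> R"
      proof (cases "q = {x}")
        case True
        then have "partition_on A (P - {q})" using D insert.hyps by simp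
        with cj True Pq show ?thesis unfolding L_def by blast
      next
        case False
        let ?p = "q - {x}"
        have ne: "?p \<noteq> {}" using False q by auto
        have sub: "q \<subseteq> insert x A" using q partition_onD1[OF P] by auto
        have "?p \<notin> P - {q}" using oth ne by (auto simp: disjnt_def)
        then have Dp: "?p \<notin> P" using q by auto
        have eqA: "A - ?p = insert x A - q" using q insert.hyps by auto
        have dj: "disjnt ?p (\<Union>(P - {q}))"
          using oth(2) by (force simp: disjnt_def)
        have "partition_on A (Set.insert ?p (P - {q}))"
          using partition_on_insert[of ?p "P - {q}" A] D eqA dj ne sub by auto
        moreover have "card (Set.insert ?p (P - {q})) = Suc j"
          using cj finP Dp by simp
        moreover have "f (Set.insert ?p (P - {q}), ?p) = P"
          unfolding f_def using Dp q by (auto simp: insert_absorb)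
        ultimately show ?thesis unfolding R_def by force
      qed
    next
      fix P' assume "P' \<in> L \<union> R"
      then show "P' \<in> {P. partition_on (insert x A) P \<and> card P = Suc j}"
      proof
        assume "P' \<in> L"
        then obtain P where P: "P' = Set.insert {x} P" "partition_on A P" "card P = j"
          unfolding L_def by auto
        have "{x} \<notin> P" using xP[OF P(2)] by auto
        moreover have "partition_on (insert x A) P'"
          using P(1,2) xP[OF P(2)] by (auto simp: partition_on_def disjoint_def)
        ultimately show ?thesis using P fin by simp
      next
        assume "P' \<in> R"
        then obtain P p where P: "P' = Set.insert (Set.insert x p) (P - {p})"
          "partition_on A P" "card P = Suc j" "p \<in> P"
          unfolding R_def f_def by auto
        have "Set.insert x p \<notin> P" using xP[OF P(2)] by auto
        moreover have "partition_on (insert x A) P'"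
          using P xP[OF P(2)] by (auto simp: partition_on_def disjoint_def)
        ultimately show ?thesis using P fin by simp
      qed
    qed
    moreover have "L \<inter> R = {}"
    proof (rule ccontr)
      assume "L \<inter> R \<noteq> {}"
      then obtain P p where P: "partition_on A P" "p \<in> P" "{x} \<in> f (P, p)"
        unfolding L_def R_def by auto
      then show False
        using xP[OF P(1)] partition_onD3[OF P(1)] unfolding f_def
        by (auto simp: subset_singleton_iff)
    qed
    moreover have "card L = Stirling (card A) j"
    proof -
      have "inj_on (Set.insert {x}) (?Q j)"
      proof (rule inj_onI)
        fix P P' assume a: "P \<in> ?Q j" "P' \<in> ?Q j" "Set.insert {x} P = Set.insert {x} P'"
        have "{x} \<notin> P" "{x} \<notin> P'" using a xP by blast+
        with a(3) show "P = P'" by (metis insert_ident)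
      qed
      then show ?thesis unfolding L_def by (simp add: card_image insert.IH)
    qed
    moreover have "card R = Suc j * Stirling (card A) (Suc j)"
    proof -
      have "inj_on f (SIGMA P:?Q (Suc j). P)"
      proof (rule inj_onI)
        fix u v assume u: "u \<in> (SIGMA P:?Q (Suc j). P)" and v: "v \<in> (SIGMA P:?Q (Suc j). P)"
          and eq: "f u = f v"
        obtain P p where uP: "u = (P, p)" "partition_on A P" "p \<in> P" using u by auto
        obtain P' p' where vP: "v = (P', p')" "partition_on A P'" "p' \<in> P'" using v by auto
        have e: "Set.insert (Set.insert x p) (P - {p}) = Set.insert (Set.insert x p') (P' - {p'})"
          using eq uP vP by (simp add: f_def)
        have n: "x \<notin> r" if "r \<in> P \<or> r \<in> P'" for r using that xP uP vP by blast
        have "Set.insert x p \<in> Set.insert (Set.insert x p') (P' - {p'})" using e by blast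
        then have "Set.insert x p = Set.insert x p'" using n by blast
        then have pp: "p = p'" using n uP vP by (metis insert_ident)
        have "P - {p} = P' - {p'}"
          using e n unfolding pp by blast
        then have "P = P'" using pp uP vP by blast
        with pp uP vP show "u = v" by simp
      qed
      then have "card R = card (SIGMA P:?Q (Suc j). P)" unfolding R_def by (rule card_image)
      also have "\<dots> = (\<Sum>P\<in>?Q (Suc j). card P)"
        using finQ fin by (subst card_SigmaI) auto
      also have "\<dots> = (\<Sum>P\<in>?Q (Suc j). Suc j)" by (rule sum.cong) auto
      finally show ?thesis by (simp add: insert.IH)
    qed
    moreover have "finite L" "finite R"
      unfolding L_def R_def using finQ fin by auto
    ultimately show ?thesis
      using Suc insert.hyps by (simp add: card_Un_disjoint)
  qed
qed

end

theory Submission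
  imports Defs
begin

text \<open>
  The idea is to remove the pair \<open>\<pm>(n + 1)\<close> from a type B partition of \<open>[-n - 1, n + 1]\<close>.
  What is left is a type B partition \<open>P\<close> of \<open>[-n, n]\<close>, and conversely the pair can be put back
  in exactly \<open>card P + 1\<close> ways: either \<open>n + 1\<close> and \<open>-(n + 1)\<close> become two new singletons, or
  \<open>n + 1\<close> joins some block \<open>p\<close> of \<open>P\<close>, which forces \<open>-(n + 1)\<close> into \<open>-p\<close>. The first way
  creates two blocks, the others create none. Writing \<open>W n k\<close> for the number of type B
  partitions of \<open>[-n, n]\<close> with \<open>k\<close> pairs of blocks besides the zero block, this says
  \<open>W (n + 1) k = W n (k - 1) + (2 k + 1) W n k\<close>.

  The numbers \<open>V n k = (\<Sum>j. (n choose j) * 2^(j - k) * Stirling j k)\<close> obey the same recurrence: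
  Pascal's rule turns \<open>n + 1\<close> into the contributions of \<open>j\<close> and of \<open>j + 1\<close>, and the Stirling
  recurrence gives \<open>2^(j + 1 - k) S(j + 1, k) = 2^(j - (k - 1)) S(j, k - 1) + 2 k 2^(j - k) S(j, k)\<close>.
  Summing over \<open>k\<close> and substituting \<open>i = n - j\<close> yields the formula.

  Instead of refining the count by the number of blocks, the proof carries an arbitrary weight
  \<open>h\<close> through the induction and evaluates the sum of \<open>h (card P)\<close> over all \<open>P\<close>. Both
  recurrences then become statements that the sum for \<open>n + 1\<close> with weight \<open>h\<close> is the sum for \<open>n\<close>
  with weight \<open>h (c + 2) + c * h c\<close>, without any bookkeeping of parities or index ranges. The
  combinatorial side is \<open>sum_signed_partition_insert\<close>, which rests on the bijection
  \<open>bij_betw_extend_partition\<close>; the arithmetical side is \<open>Stirling_sum_Suc\<close> and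
  \<open>binomial_sum_Suc\<close>; they meet in \<open>sum_card_signed_partition\<close>.
\<close>

section \<open>Partitions invariant under negation\<close>

definition neg :: "int set \<Rightarrow> int set" where
  "neg b = uminus ` b"

lemma in_neg [simp]: "a \<in> neg b \<longleftrightarrow> - a \<in> b"
  unfolding neg_def by (metis add.inverse_inverse image_iff)

lemma neg_neg [simp]: "neg (neg b) = b"
  by (auto simp: set_eq_iff)

lemma neg_empty [simp]: "neg {} = {}"
  by (auto simp: set_eq_iff)

lemma neg_eq_empty [simp]: "neg b = {} \<longleftrightarrow> b = {}"
  by (metis neg_neg neg_empty)

lemma neg_insert [simp]: "neg (insert a b) = insert (- a) (neg b)"
  by (simp add: neg_def)

lemma neg_mono: "b \<subseteq> c \<Longrightarrow> neg b \<subseteq> neg c"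
  by auto

lemma neg_Diff_doubleton: "neg (b - {x, - x}) = neg b - {x, - x}"
  by (simp add: neg_def image_set_diff insert_commute)

text \<open>
  Type B partitions of an arbitrary ground set of integers. If \<open>0\<close> lies in the ground set, its
  block is automatically fixed by negation, so that the uniqueness of the fixed block can be
  expressed by saying that every fixed block contains \<open>0\<close>. This universal condition is easier
  to transport along the bijection than unique existence.
\<close>

definition signed_partition :: "int set \<Rightarrow> int set set \<Rightarrow> bool" where
  "signed_partition A P \<longleftrightarrow>
     partition_on A P \<and> (\<forall>b\<in>P. neg b \<in> P) \<and> (\<forall>b\<in>P. neg b = b \<longrightarrow> 0 \<in> b)"

lemma same_block:
  assumes "partition_on A P" "b \<in> P" "c \<in> P" "a \<in> b" "a \<in> c"
  shows "b = c"
  using partition_onD2[OF assms(1)] assms(2-) by (auto simp: disjoint_def)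

lemma type_B_partition_iff_signed_partition:
  "type_B_partition n P \<longleftrightarrow> signed_partition {- int n..int n} P"
proof -
  have "(\<exists>!b. b \<in> P \<and> neg b = b) \<longleftrightarrow> (\<forall>b\<in>P. neg b = b \<longrightarrow> 0 \<in> b)"
    if P: "partition_on {- int n..int n} P" and sym: "\<forall>b\<in>P. neg b \<in> P"
  proof -
    have "0 \<in> \<Union>P" using partition_onD1[OF P] by auto
    then obtain z where z: "z \<in> P" "0 \<in> z" by blast
    have "neg z = z" using same_block[OF P, of "neg z" z 0] sym z by simp
    then show ?thesis using z same_block[OF P] by metis
  qed
  then show ?thesis
    unfolding type_B_partition_def signed_partition_def neg_def[symmetric] by (simp cong: conj_cong)
qed

section \<open>Inserting and removing a pair of opposite elements\<close>

text \<open>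
  The block of \<open>x\<close> after \<open>x\<close> has joined \<open>p\<close>. The zero block must receive \<open>-x\<close> as well, in
  order to remain fixed by negation. The value \<open>p = {}\<close> encodes the choice of opening a new
  block for \<open>x\<close>; the empty set is also fixed by negation and so has to be excluded in the test for
  the zero block.
\<close>

definition extend_block :: "int \<Rightarrow> int set \<Rightarrow> int set" where
  "extend_block x p = (if p \<noteq> {} \<and> neg p = p then insert x (insert (- x) p) else insert x p)"

definition extend_partition :: "int \<Rightarrow> int set set \<Rightarrow> int set \<Rightarrow> int set set" where
  "extend_partition x P p =
     insert (extend_block x p) (insert (neg (extend_block x p)) (P - {p, neg p}))"

text \<open>
  The two components of the inverse: the old partition, and the block that \<open>x\<close> has joined. The
  latter is empty exactly if \<open>x\<close> formed a singleton block.
\<close>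

definition restrict_partition :: "int \<Rightarrow> int set set \<Rightarrow> int set set" where
  "restrict_partition x Q = (\<lambda>b. b - {x, - x}) ` Q - {{}}"

definition punctured_block :: "int \<Rightarrow> int set set \<Rightarrow> int set" where
  "punctured_block x Q = \<Union>{b \<in> Q. x \<in> b} - {x, - x}"

context
  fixes A :: "int set" and x :: int
  assumes zero: "0 \<in> A" and A: "neg A = A" and x: "x \<notin> A"
begin

lemma fresh_element: "x \<noteq> 0" "- x \<notin> A" "- x \<noteq> x" "x \<noteq> - x"
proof -
  show "x \<noteq> 0" using zero x by blast
  then show "- x \<noteq> x" "x \<noteq> - x" by presburger+
  show "- x \<notin> A" using A x in_neg by blast
qed

lemma block_properties:
  assumes "signed_partition A P" "p \<in> insert {} P"
  shows "neg p \<in> insert {} P" "x \<notin> p" "- x \<notin> p" "p \<subseteq> A"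
    "{} \<notin> P" "\<And>a. a \<in> p \<Longrightarrow> - a \<in> p \<Longrightarrow> neg p = p"
proof -
  have P: "partition_on A P" and s: "\<forall>b\<in>P. neg b \<in> P"
    using assms unfolding signed_partition_def by auto
  show sub: "p \<subseteq> A" using partition_onD1[OF P] assms(2) by auto
  show "neg p \<in> insert {} P" using s assms by auto
  show "x \<notin> p" "- x \<notin> p" using sub x fresh_element by auto
  show "{} \<notin> P" using partition_onD3[OF P] by blast
  show "neg p = p" if "a \<in> p" "- a \<in> p" for a
  proof -
    have "p \<in> P" using that assms(2) by blast
    then show ?thesis using same_block[OF P, of "neg p" p a] s that by simp
  qed
qed

lemma neg_extend_block:
  assumes "signed_partition A P" "p \<in> insert {} P"
  shows "neg (extend_block x p) =
    (if p \<noteq> {} \<and> neg p = p then extend_block x p else insert (- x) (neg p))"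
  unfolding extend_block_def by (simp add: insert_commute)

lemma extend_block_Diff:
  assumes "signed_partition A P" "p \<in> insert {} P"
  shows "extend_block x p - {x, - x} = p" "neg (extend_block x p) - {x, - x} = neg p"
proof -
  show *: "extend_block x p - {x, - x} = p"
    using block_properties[OF assms] unfolding extend_block_def by auto
  show "neg (extend_block x p) - {x, - x} = neg p"
    using arg_cong[OF *, of neg] unfolding neg_Diff_doubleton .
qed

text \<open>
  The new block \<open>g\<close> of \<open>x\<close> and the block \<open>-g\<close> agree or are disjoint according to whether \<open>p\<close> is
  the zero block. In particular no second block fixed by negation arises: if \<open>g\<close> is fixed, it contains
  both \<open>x\<close> and \<open>-x\<close>, which happens only for the zero block.
\<close>

lemma signed_partition_extend_partition:
  assumes P: "signed_partition A P" and p: "p \<in> insert {} P"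
  shows "signed_partition (insert x (insert (- x) A)) (extend_partition x P p)"
proof -
  note f = block_properties[OF P]
  let ?g = "extend_block x p"
  let ?R = "P - {p, neg p}"
  have part: "partition_on A P" using P unfolding signed_partition_def by auto
  have gsub: "?g \<subseteq> insert x (insert (- x) p)" "p \<subseteq> ?g" "x \<in> ?g"
    unfolding extend_block_def by auto
  have ngsub: "neg ?g \<subseteq> insert x (insert (- x) (neg p))" "neg p \<subseteq> neg ?g" "- x \<in> neg ?g"
    using gsub neg_mono[OF gsub(1)] neg_mono[OF gsub(2)] by (simp_all add: insert_commute)
  have U: "\<Union>(extend_partition x P p) = insert x (insert (- x) A)"
  proof -
    have "\<Union>?R \<union> p \<union> neg p = A"
      using partition_onD1[OF part] p f(1)[OF p] by auto
    then show ?thesis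
      using gsub ngsub unfolding extend_partition_def by auto
  qed
  have gn: "?g = neg ?g \<or> ?g \<inter> neg ?g = {}"
  proof (cases "p \<noteq> {} \<and> neg p = p")
    case True
    then show ?thesis using neg_extend_block[OF P p] by simp
  next
    case False
    then have "p \<inter> neg p = {}" using f(6)[OF p] by auto
    moreover have "?g = insert x p" "neg ?g = insert (- x) (neg p)"
      using False neg_extend_block[OF P p] by (auto simp: extend_block_def)
    ultimately show ?thesis using f(2,3)[OF p] fresh_element by auto
  qed
  have R: "r \<inter> ?g = {}" "r \<inter> neg ?g = {}" if "r \<in> ?R" for r
  proof -
    have rx: "x \<notin> r" "- x \<notin> r" using f that by auto
    have "r \<inter> p = {}" "r \<inter> neg p = {}"
      using same_block[OF part, of r p] same_block[OF part, of r "neg p"] that p f(1)[OF p] by auto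
    then show "r \<inter> ?g = {}" "r \<inter> neg ?g = {}" using rx gsub ngsub by auto
  qed
  have "disjoint ?R" using partition_onD2[OF part] by (auto simp: disjoint_def)
  then have "disjoint (extend_partition x P p)"
    unfolding extend_partition_def disjoint_def using R gn by (simp add: Int_commute) blast
  moreover have "{} \<notin> extend_partition x P p"
    using gsub(3) ngsub(3) f(5)[OF p] unfolding extend_partition_def by blast
  ultimately have 1: "partition_on (insert x (insert (- x) A)) (extend_partition x P p)"
    using U by (simp add: partition_on_def)
  have sym: "\<forall>b\<in>P. neg b \<in> P" and zero_block: "\<forall>b\<in>P. neg b = b \<longrightarrow> 0 \<in> b"
    using P unfolding signed_partition_def by auto
  have "neg b \<in> ?R" if "b \<in> ?R" for b
    using that sym neg_neg by (metis DiffD1 DiffD2 DiffI insert_iff singletonD)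
  then have 2: "\<forall>b\<in>extend_partition x P p. neg b \<in> extend_partition x P p"
    unfolding extend_partition_def by (metis insert_iff neg_neg)
  have "0 \<in> ?g" if "neg ?g = ?g"
  proof -
    have "- x \<in> ?g" using that gsub in_neg by blast
    then have "p \<noteq> {} \<and> neg p = p"
      using f(3)[OF p] fresh_element unfolding extend_block_def by (auto split: if_splits)
    then have "0 \<in> p" using P p unfolding signed_partition_def by auto
    then show ?thesis using gsub by auto
  qed
  then have 3: "\<forall>b\<in>extend_partition x P p. neg b = b \<longrightarrow> 0 \<in> b"
    using zero_block unfolding extend_partition_def by (metis DiffD1 insert_iff neg_neg)
  from 1 2 3 show ?thesis unfolding signed_partition_def by blast
qed

lemma block_avoids:
  assumes "signed_partition A P" "b \<in> P"
  shows "x \<notin> b" "- x \<notin> b" "b - {x, - x} = b" "b \<noteq> {}"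
  using block_properties(2,3,5)[of P b] assms by auto

lemma restrict_extend_partition:
  assumes P: "signed_partition A P" and p: "p \<in> insert {} P"
  shows "restrict_partition x (extend_partition x P p) = P"
proof -
  have "(\<lambda>b. b - {x, - x}) ` (P - {p, neg p}) = id ` (P - {p, neg p})"
    by (rule image_cong) (simp_all add: block_avoids[OF P])
  then have "restrict_partition x (extend_partition x P p) = insert p (insert (neg p) P) - {{}}"
    unfolding restrict_partition_def extend_partition_def image_insert extend_block_Diff[OF P p]
    by auto
  also have "\<dots> = P"
    using p block_properties(1)[OF P p] block_properties(5)[OF P p] by auto
  finally show ?thesis .
qed

lemma punctured_block_extend_partition:
  assumes P: "signed_partition A P" and p: "p \<in> insert {} P"
  shows "punctured_block x (extend_partition x P p) = p"
proof -
  have "x \<in> extend_block x p" unfolding extend_block_def by simp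
  moreover have "neg (extend_block x p) = extend_block x p" if "x \<in> neg (extend_block x p)"
  proof -
    have "- x \<in> extend_block x p" using that by simp
    then have "p \<noteq> {} \<and> neg p = p"
      using block_properties(3)[OF P p] fresh_element unfolding extend_block_def by (auto split: if_splits)
    then show ?thesis using neg_extend_block[OF P p] by simp
  qed
  ultimately have "{b \<in> extend_partition x P p. x \<in> b} = {extend_block x p}"
    using block_avoids(1)[OF P] unfolding extend_partition_def by blast
  then show ?thesis
    using extend_block_Diff[OF P p] unfolding punctured_block_def by simp
qed

text \<open>
  A trace \<open>b - {x, -x}\<close> that is nonempty and fixed by negation has an element whose opposite
  lies in \<open>b\<close> too, so that \<open>b\<close> is itself fixed and hence contains \<open>0\<close>.
\<close>

lemma signed_partition_restrict_partition:
  assumes Q: "signed_partition (insert x (insert (- x) A)) Q"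
  shows "signed_partition A (restrict_partition x Q)"
proof -
  have part: "partition_on (insert x (insert (- x) A)) Q" and s: "\<forall>b\<in>Q. neg b \<in> Q"
    and z: "\<forall>b\<in>Q. neg b = b \<longrightarrow> 0 \<in> b"
    using Q unfolding signed_partition_def by auto
  have "\<Union>(restrict_partition x Q) = \<Union>Q - {x, - x}"
    unfolding restrict_partition_def by auto
  also have "\<dots> = A" using partition_onD1[OF part] x fresh_element by auto
  finally have U: "\<Union>(restrict_partition x Q) = A" .
  have "disjoint (restrict_partition x Q)"
    using partition_onD2[OF part] unfolding restrict_partition_def disjoint_def by blast
  then have 1: "partition_on A (restrict_partition x Q)"
    using U by (simp add: partition_on_def restrict_partition_def)
  have 2: "neg c \<in> restrict_partition x Q" if c: "c \<in> restrict_partition x Q" for c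
  proof -
    from c obtain b where b: "b \<in> Q" "c = b - {x, - x}" "c \<noteq> {}"
      unfolding restrict_partition_def by auto
    have "neg c = neg b - {x, - x}" unfolding b(2) by (rule neg_Diff_doubleton)
    moreover have "neg c \<noteq> {}" using b by simp
    ultimately show ?thesis using b s unfolding restrict_partition_def by auto
  qed
  have 3: "0 \<in> c" if c: "c \<in> restrict_partition x Q" and n: "neg c = c" for c
  proof -
    from c obtain b where b: "b \<in> Q" "c = b - {x, - x}" "c \<noteq> {}"
      unfolding restrict_partition_def by auto
    then obtain a where a: "a \<in> c" by auto
    then have "- a \<in> c" using n in_neg by blast
    then have "neg b = b" using same_block[OF part, of "neg b" b a] a b s by auto
    then show ?thesis using z b fresh_element by auto
  qed
  from 1 2 3 show ?thesis unfolding signed_partition_def by blast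
qed

text \<open>
  The block \<open>b\<close> of \<open>x\<close> can be recovered from its trace. If \<open>b\<close> is fixed by negation, then its
  trace contains \<open>0\<close> and is thus recognised as the zero block. Otherwise \<open>b\<close> and \<open>-b\<close> are
  disjoint, so \<open>-x\<close> is not in \<open>b\<close> and the trace is not a nonempty fixed set.
\<close>

lemma signed_partition_block_of_x:
  assumes Q: "signed_partition (insert x (insert (- x) A)) Q"
  obtains b where "b \<in> Q" "x \<in> b" "punctured_block x Q = b - {x, - x}"
    "extend_block x (b - {x, - x}) = b"
proof -
  have part: "partition_on (insert x (insert (- x) A)) Q" and s: "\<forall>b\<in>Q. neg b \<in> Q"
    and z: "\<forall>b\<in>Q. neg b = b \<longrightarrow> 0 \<in> b"
    using Q unfolding signed_partition_def by auto
  have "x \<in> \<Union>Q" using partition_onD1[OF part] by auto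
  then obtain b where b: "b \<in> Q" "x \<in> b" by auto
  have "{c \<in> Q. x \<in> c} = {b}" using same_block[OF part] b by blast
  then have 1: "punctured_block x Q = b - {x, - x}" unfolding punctured_block_def by simp
  let ?p = "b - {x, - x}"
  have np: "neg ?p = neg b - {x, - x}" by (rule neg_Diff_doubleton)
  have "extend_block x ?p = b"
  proof (cases "neg b = b")
    case True
    then have "0 \<in> ?p" using z b fresh_element by auto
    moreover have "- x \<in> b" using True b in_neg by (metis neg_neg)
    moreover have "neg ?p = ?p" using np True by simp
    ultimately have "extend_block x ?p = insert x (insert (- x) ?p)"
      unfolding extend_block_def by (intro if_P) blast
    also have "\<dots> = b" using b \<open>- x \<in> b\<close> by blast
    finally show ?thesis .
  next
    case False
    then have d: "b \<inter> neg b = {}" using same_block[OF part, of b "neg b"] s b by auto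
    then have "- x \<notin> b" using b by auto
    have "\<not> (?p \<noteq> {} \<and> neg ?p = ?p)" using d unfolding np by blast
    then have "extend_block x ?p = insert x ?p"
      unfolding extend_block_def by (rule if_not_P)
    also have "\<dots> = b" using b \<open>- x \<notin> b\<close> by blast
    finally show ?thesis .
  qed
  with 1 b that show thesis by blast
qed

lemma punctured_block_in:
  assumes Q: "signed_partition (insert x (insert (- x) A)) Q"
  shows "punctured_block x Q \<in> insert {} (restrict_partition x Q)"
proof -
  obtain b where "b \<in> Q" "punctured_block x Q = b - {x, - x}"
    by (rule signed_partition_block_of_x[OF Q])
  then show ?thesis unfolding restrict_partition_def by simp
qed

lemma extend_restrict_partition:
  assumes Q: "signed_partition (insert x (insert (- x) A)) Q"
  shows "extend_partition x (restrict_partition x Q) (punctured_block x Q) = Q"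
proof -
  have part: "partition_on (insert x (insert (- x) A)) Q" and s: "\<forall>b\<in>Q. neg b \<in> Q"
    using Q unfolding signed_partition_def by auto
  obtain b where b: "b \<in> Q" "x \<in> b" and p: "punctured_block x Q = b - {x, - x}"
    and e: "extend_block x (b - {x, - x}) = b"
    using signed_partition_block_of_x[OF Q] by blast
  let ?d = "\<lambda>c. c - {x, - x}"
  have np: "neg (?d b) = ?d (neg b)" by (rule neg_Diff_doubleton)
  have nb: "neg b \<in> Q" "- x \<in> neg b" using s b by auto
  have other: "?d c = c" "c \<noteq> {}" "c \<noteq> ?d b" "c \<noteq> ?d (neg b)"
    if c: "c \<in> Q - {b, neg b}" for c
  proof -
    show ne: "c \<noteq> {}" using c partition_onD3[OF part] by auto
    have "c \<inter> b = {}" "c \<inter> neg b = {}"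
      using c same_block[OF part, of c b] same_block[OF part, of c "neg b"] b nb by auto
    then show "?d c = c" "c \<noteq> ?d b" "c \<noteq> ?d (neg b)" using b nb ne by auto
  qed
  have Q_eq: "Q = insert b (insert (neg b) (Q - {b, neg b}))" using b nb by blast
  then have "?d ` Q = insert (?d b) (insert (?d (neg b)) (?d ` (Q - {b, neg b})))"
    by (metis image_insert)
  also have "?d ` (Q - {b, neg b}) = id ` (Q - {b, neg b})"
    by (rule image_cong) (simp_all only: other(1) id_apply)
  finally have im: "?d ` Q = insert (?d b) (insert (?d (neg b)) (Q - {b, neg b}))"
    by (simp only: image_id id_apply)
  \<comment> \<open>The traces of \<open>b\<close> and \<open>neg b\<close> will be \<open>u\<close> and \<open>v\<close>; they are empty if \<open>b = {x}\<close>.\<close>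
  have cancel: "insert u (insert v T) - {{}} - {u, v} = T"
    if "u \<notin> T" "v \<notin> T" "{} \<notin> T" for u v :: "int set" and T
    using that by auto
  have "restrict_partition x Q - {?d b, ?d (neg b)} = Q - {b, neg b}"
    unfolding restrict_partition_def im
  proof (rule cancel)
    show "?d b \<notin> Q - {b, neg b}" using other(3) by metis
    show "?d (neg b) \<notin> Q - {b, neg b}" using other(4) by metis
    show "{} \<notin> Q - {b, neg b}" using other(2) by metis
  qed
  then show ?thesis
    unfolding extend_partition_def p np e using Q_eq by metis
qed

lemma bij_betw_extend_partition:
  "bij_betw (\<lambda>(P, p). extend_partition x P p)
     (SIGMA P:{P. signed_partition A P}. insert {} P)
     {Q. signed_partition (insert x (insert (- x) A)) Q}"
proof (rule bij_betw_byWitness[where f' = "\<lambda>Q. (restrict_partition x Q, punctured_block x Q)"])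
  show "\<forall>u\<in>SIGMA P:{P. signed_partition A P}. insert {} P.
    (restrict_partition x (case u of (P, p) \<Rightarrow> extend_partition x P p),
     punctured_block x (case u of (P, p) \<Rightarrow> extend_partition x P p)) = u"
  proof
    fix u assume "u \<in> (SIGMA P:{P. signed_partition A P}. insert {} P)"
    then obtain P p where u: "u = (P, p)" "signed_partition A P" "p \<in> insert {} P"
      by (elim SigmaE) simp
    show "(restrict_partition x (case u of (P, p) \<Rightarrow> extend_partition x P p),
        punctured_block x (case u of (P, p) \<Rightarrow> extend_partition x P p)) = u"
      unfolding u(1) prod.case restrict_extend_partition[OF u(2,3)]
        punctured_block_extend_partition[OF u(2,3)] by (rule refl)
  qed
  show "\<forall>Q\<in>{Q. signed_partition (insert x (insert (- x) A)) Q}.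
    (case (restrict_partition x Q, punctured_block x Q) of (P, p) \<Rightarrow> extend_partition x P p) = Q"
    by (intro ballI) (simp only: mem_Collect_eq prod.case extend_restrict_partition)
  show "(\<lambda>(P, p). extend_partition x P p) ` (SIGMA P:{P. signed_partition A P}. insert {} P)
    \<subseteq> {Q. signed_partition (insert x (insert (- x) A)) Q}"
    by (intro image_subsetI, elim SigmaE)
      (simp only: mem_Collect_eq prod.case signed_partition_extend_partition)
  show "(\<lambda>Q. (restrict_partition x Q, punctured_block x Q)) `
      {Q. signed_partition (insert x (insert (- x) A)) Q}
    \<subseteq> (SIGMA P:{P. signed_partition A P}. insert {} P)"
    by (intro image_subsetI)
      (simp only: mem_Collect_eq mem_Sigma_iff signed_partition_restrict_partition
        punctured_block_in simp_thms)
qed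

text \<open>
  The pair \<open>p, -p\<close> is replaced by \<open>g, -g\<close>, and the two members of the first pair coincide
  exactly when those of the second do. Only for \<open>p = {}\<close> is nothing removed; then \<open>g = {x}\<close> and
  \<open>-g = {-x}\<close> are two additional blocks.
\<close>

lemma card_extend_partition:
  assumes P: "signed_partition A P" and p: "p \<in> insert {} P" and fin: "finite P"
  shows "card (extend_partition x P p) = card P + (if p = {} then 2 else 0)"
proof -
  note f = block_properties[OF P p]
  let ?g = "extend_block x p"
  have "x \<in> ?g" "- x \<in> neg ?g" unfolding extend_block_def by simp_all
  then have notin: "?g \<notin> P" "neg ?g \<notin> P"
    using block_avoids(1,2)[OF P] by blast+
  have eq: "?g = neg ?g \<longleftrightarrow> p \<noteq> {} \<and> neg p = p"
  proof
    assume "?g = neg ?g"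
    then have "- x \<in> ?g" using \<open>- x \<in> neg ?g\<close> by simp
    then show "p \<noteq> {} \<and> neg p = p"
      using f(3) fresh_element unfolding extend_block_def by (auto split: if_splits)
  qed (use neg_extend_block[OF P p] in simp)
  have 1: "card (extend_partition x P p) = card {?g, neg ?g} + card (P - {p, neg p})"
  proof -
    have "extend_partition x P p = {?g, neg ?g} \<union> (P - {p, neg p})"
      unfolding extend_partition_def by auto
    then show ?thesis using notin fin by (simp add: card_Un_disjoint del: Un_insert_left)
  qed
  show ?thesis
  proof (cases "p = {}")
    case True
    then show ?thesis using 1 eq f(5) by simp
  next
    case False
    then have sub: "{p, neg p} \<subseteq> P" using p f(1) by auto
    have "card {?g, neg ?g} = card {p, neg p}"
      using eq False by (cases "neg p = p") (simp_all add: eq_commute[of p "neg p"])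
    moreover have "card {p, neg p} \<le> card P" using sub fin by (rule card_mono[rotated])
    ultimately show ?thesis using 1 False sub fin by (simp add: card_Diff_subset)
  qed
qed

text \<open>
  Along the bijection, each \<open>P\<close> contributes one partition with two more blocks and, for each of
  its blocks, one partition with equally many blocks.
\<close>

lemma sum_signed_partition_insert:
  fixes h :: "nat \<Rightarrow> nat"
  assumes fin: "finite A"
  shows "(\<Sum>Q | signed_partition (insert x (insert (- x) A)) Q. h (card Q)) =
    (\<Sum>P | signed_partition A P. h (card P + 2) + card P * h (card P))"
proof -
  let ?S = "{P. signed_partition A P}"
  have finS: "finite ?S"
    using finitely_many_partition_on[OF fin]
    by (rule rev_finite_subset) (auto simp: signed_partition_def)
  have finP: "finite P" if "signed_partition A P" for P
    using that finite_elements[OF fin] by (auto simp: signed_partition_def)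
  have "(\<Sum>Q | signed_partition (insert x (insert (- x) A)) Q. h (card Q)) =
      (\<Sum>u\<in>(SIGMA P:?S. insert {} P). h (card ((\<lambda>(P, p). extend_partition x P p) u)))"
    by (rule sum.reindex_bij_betw[OF bij_betw_extend_partition, symmetric])
  also have "\<dots> = (\<Sum>u\<in>(SIGMA P:?S. insert {} P).
      case u of (P, p) \<Rightarrow> h (card P + (if p = {} then 2 else 0)))"
  proof (rule sum.cong[OF refl])
    fix u assume "u \<in> (SIGMA P:?S. insert {} P)"
    then obtain P p where u: "u = (P, p)" "signed_partition A P" "p \<in> insert {} P"
      by (elim SigmaE) simp
    show "h (card (case u of (P, p) \<Rightarrow> extend_partition x P p)) =
        (case u of (P, p) \<Rightarrow> h (card P + (if p = {} then 2 else 0)))"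
      unfolding u(1) prod.case card_extend_partition[OF u(2,3) finP[OF u(2)]] by (rule refl)
  qed
  also have "\<dots> = (\<Sum>P\<in>?S. \<Sum>p\<in>insert {} P. h (card P + (if p = {} then 2 else 0)))"
    using finS finP by (subst sum.Sigma) auto
  also have "\<dots> = (\<Sum>P\<in>?S. h (card P + 2) + card P * h (card P))"
  proof (rule sum.cong)
    fix P assume "P \<in> ?S"
    then have P: "signed_partition A P" by simp
    have e: "{} \<notin> P" using block_properties(5)[OF P, of "{}"] by simp
    have "(\<Sum>p\<in>P. h (card P + (if p = {} then 2 else 0))) = (\<Sum>p\<in>P. h (card P))"
      by (rule sum.cong) (use e in auto)
    then show "(\<Sum>p\<in>insert {} P. h (card P + (if p = {} then 2 else 0))) =
      h (card P + 2) + card P * h (card P)"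
      using finP[OF P] e by simp
  qed simp
  finally show ?thesis .
qed

end

section \<open>The recurrence for the weighted Stirling numbers\<close>

text \<open>
  This counts the ways to partition \<open>m\<close> elements into \<open>k\<close> blocks and to choose a relative sign
  for every element that is not the least in its block. Truncated subtraction in the exponent
  is harmless since the Stirling number vanishes for \<open>m < k\<close>.
\<close>

definition two_Stirling :: "nat \<Rightarrow> nat \<Rightarrow> nat" where
  "two_Stirling m k = 2 ^ (m - k) * Stirling m k"

lemma two_Stirling_0 [simp]: "two_Stirling (Suc m) 0 = 0" "two_Stirling 0 0 = 1"
  by (simp_all add: two_Stirling_def)

lemma two_Stirling_eq_0: "m < k \<Longrightarrow> two_Stirling m k = 0"
  by (simp add: two_Stirling_def)

lemma two_Stirling_Suc:
  "two_Stirling (Suc m) (Suc k) = two_Stirling m k + 2 * Suc k * two_Stirling m (Suc k)"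
proof (cases "Suc k \<le> m")
  case True
  then have "m - k = Suc (m - Suc k)" by simp
  then show ?thesis by (simp add: two_Stirling_def algebra_simps)
next
  case False
  then show ?thesis by (simp add: two_Stirling_def)
qed

definition Stirling_sum :: "nat \<Rightarrow> (nat \<Rightarrow> nat) \<Rightarrow> nat" where
  "Stirling_sum m h = (\<Sum>k\<le>m. two_Stirling m k * h k)"

text \<open>
  The Stirling recurrence acts on sums against a weight through the transposed operation on
  weights.
\<close>

lemma Stirling_sum_Suc:
  "Stirling_sum (Suc m) h = Stirling_sum m (\<lambda>k. h (Suc k) + 2 * k * h k)"
proof -
  have "Stirling_sum (Suc m) h =
      (\<Sum>k\<le>m. two_Stirling m k * h (Suc k)) +
      (\<Sum>k\<le>m. two_Stirling m (Suc k) * (2 * Suc k * h (Suc k)))"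
    unfolding Stirling_sum_def
    by (subst sum.atMost_Suc_shift) (simp add: two_Stirling_Suc sum.distrib algebra_simps)
  also have "(\<Sum>k\<le>m. two_Stirling m (Suc k) * (2 * Suc k * h (Suc k))) =
      (\<Sum>k\<le>Suc m. two_Stirling m k * (2 * k * h k))"
    by (subst sum.atMost_Suc_shift) simp
  also have "\<dots> = (\<Sum>k\<le>m. two_Stirling m k * (2 * k * h k))"
    by (simp add: two_Stirling_eq_0)
  finally show ?thesis
    by (simp add: Stirling_sum_def sum.distrib algebra_simps)
qed

text \<open>
  Pascal's rule in summed form: an element added to a set of size \<open>n\<close> is either omitted from the
  chosen subset or enlarges it.
\<close>

lemma binomial_sum_Suc:
  fixes a :: "nat \<Rightarrow> nat"
  shows "(\<Sum>j\<le>Suc n. (Suc n choose j) * a j) = (\<Sum>j\<le>n. (n choose j) * (a j + a (Suc j)))"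
proof -
  have "(\<Sum>j\<le>Suc n. (Suc n choose j) * a j) =
      (\<Sum>j\<le>n. (n choose j) * a (Suc j)) + (a 0 + (\<Sum>j\<le>n. (n choose Suc j) * a (Suc j)))"
    by (subst sum.atMost_Suc_shift) (simp add: sum.distrib algebra_simps)
  also have "a 0 + (\<Sum>j\<le>n. (n choose Suc j) * a (Suc j)) = (\<Sum>j\<le>Suc n. (n choose j) * a j)"
    by (subst sum.atMost_Suc_shift) simp
  also have "\<dots> = (\<Sum>j\<le>n. (n choose j) * a j)" by simp
  finally show ?thesis by (simp add: sum.distrib algebra_simps)
qed

section \<open>Counting type B partitions\<close>

text \<open>
  Passing from \<open>n\<close> to \<open>n + 1\<close> replaces \<open>h c\<close> by \<open>h (c + 2) + c * h c\<close>. At \<open>c = 2 k + 1\<close> this is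
  \<open>h (2 k + 1)\<close> plus the weight \<open>h (2 (k + 1) + 1) + 2 k * h (2 k + 1)\<close> that the Stirling recurrence
  produces; these two parts are the two terms of Pascal's rule.
\<close>

lemma sum_card_signed_partition:
  "(\<Sum>P | signed_partition {- int n..int n} P. h (card P)) =
    (\<Sum>j\<le>n. (n choose j) * Stirling_sum j (\<lambda>k. h (2 * k + 1)))"
proof (induction n arbitrary: h)
  case 0
  have "signed_partition {0} P \<longleftrightarrow> P = {{0}}" for P
  proof
    assume "signed_partition {0} P"
    then have "partition_on {0} P" by (simp add: signed_partition_def)
    then have "\<Union>P = {0}" "{} \<notin> P" using partition_onD1 partition_onD3 by blast+
    then have "\<forall>p\<in>P. p = {0}" "P \<noteq> {}" by (metis Sup_upper subset_singletonD, auto)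
    then show "P = {{0}}" by auto
  qed (simp add: signed_partition_def partition_on_def disjoint_def)
  then show ?case by (simp add: Stirling_sum_def)
next
  case (Suc n)
  let ?A = "{- int n..int n}"
  have A: "{- int (Suc n)..int (Suc n)} = insert (int n + 1) (insert (- (int n + 1)) ?A)"
    by auto
  have "(\<Sum>P | signed_partition {- int (Suc n)..int (Suc n)} P. h (card P)) =
      (\<Sum>P | signed_partition ?A P. h (card P + 2) + card P * h (card P))"
    unfolding A by (rule sum_signed_partition_insert) (auto simp: set_eq_iff)
  also have "\<dots> = (\<Sum>j\<le>n. (n choose j) *
      Stirling_sum j (\<lambda>k. h (2 * k + 1 + 2) + (2 * k + 1) * h (2 * k + 1)))"
    by (rule Suc.IH)
  also have "\<dots> = (\<Sum>j\<le>n. (n choose j) *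
      (Stirling_sum j (\<lambda>k. h (2 * k + 1)) + Stirling_sum (Suc j) (\<lambda>k. h (2 * k + 1))))"
    unfolding Stirling_sum_Suc
    by (simp add: Stirling_sum_def sum.distrib algebra_simps)
  also have "\<dots> = (\<Sum>j\<le>Suc n. (Suc n choose j) * Stirling_sum j (\<lambda>k. h (2 * k + 1)))"
    by (rule binomial_sum_Suc[symmetric])
  finally show ?case .
qed

theorem corollary4p7:
  fixes n :: nat
  assumes "n \<ge> 1"
  shows "dowling_number n =
    (\<Sum>i=0..n. (n choose i) * (\<Sum>k=0..n - i. 2 ^ (n - i - k) * Stirling (n - i) k))"
proof -
  have "dowling_number n = (\<Sum>P | signed_partition {- int n..int n} P. 1)"
    unfolding dowling_number_def type_B_partition_iff_signed_partition by simp
  also have "\<dots> = (\<Sum>j\<le>n. (n choose j) * Stirling_sum j (\<lambda>_. 1))"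
    by (rule sum_card_signed_partition)
  also have "\<dots> = (\<Sum>i\<le>n. (n choose (n - i)) * Stirling_sum (n - i) (\<lambda>_. 1))"
    by (rule sum.reindex_bij_witness[where i = "\<lambda>i. n - i" and j = "\<lambda>i. n - i"]) auto
  also have "\<dots> = (\<Sum>i=0..n. (n choose i) * (\<Sum>k=0..n - i. 2 ^ (n - i - k) * Stirling (n - i) k))"
    unfolding atMost_atLeast0 Stirling_sum_def two_Stirling_def
    by (rule sum.cong) (auto simp: binomial_symmetric[symmetric])
  finally show ?thesis .
qed

end
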